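(* Let $K=\mathbf{Q}(\sqrt{-3})$, $\omega=\exp(2\pi i/3)$, $\mathcal{O}=\mathbf{Z}[\omega]$, $\lambda=\omega-\omega^2=\sqrt{-3}$, and for $\alpha\in K$ let $T(\alpha)=\alpha+\overline{\alpha}$. For $\alpha\in\mathcal{O}$ let $\chi(\alpha)=\omega^a$, where $a\in\mathbf{Z}$ satisfies $\alpha\equiv a\pmod{\lambda\mathcal{O}}$. For integers $k$ define the formal series $$a(q,z,w)=\sum_{\alpha\in\mathcal{O}}q^{|\alpha|^2}z^{T(\alpha)}w^{T(\alpha/\lambda)},\qquad b_k(q,z,w)=\sum_{\alpha\in\mathcal{O}}\chi(\alpha)^kq^{|\alpha|^2}z^{T(\alpha)}w^{T(\alpha/\lambda)},$$ $$c_k(q,z,w)=\sum_{\alpha\in\mathcal{O}+k/\lambda}q^{|\alpha|^2}z^{T(\alpha)}w^{T(\alpha/\lambda)},$$ and set $a(q)=a(q,1,1)$, $b(q)=b_1(q,1,1)$, $c(q)=c_1(q,1,1)$. Then for each integer $k$, $$3c_k(q,z,w)c_k(q^2,z^2,w^2)=a(q,w,z^{-3})a(q^2)+\omega^k b_1(q,w,z^{-3})b(q^2)+\omega^{-k}b_{-1}(q,w,z^{-3})b(q^2)+c_1(q,w,z^{-3})c(q^2)+c_{-1}(q,w,z^{-3})c(q^2).$$ In particular $$3a(q,z,w)a(q^2,z^2,w^2)=a(q,w,z^{-3})a(q^2)+b_1(q,w,z^{-3})b(q^2)+b_{-1}(q,w,z^{-3})b(q^2)+c_1(q,w,z^{-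3})c(q^2)+c_{-1}(q,w,z^{-3})c(q^2).$$
   Context: $\chi$ is well defined since $\mathbf{Z}\to\mathcal{O}$ induces an isomorphism $\mathbf{Z}/3\mathbf{Z}\cong\mathcal{O}/\lambda\mathcal{O}$. The series are formal series in $q,z,w$ with rational exponents; e.g. $a(q,w,z^{-3})$ denotes $\sum_{\alpha\in\mathcal{O}}q^{|\alpha|^2}w^{T(\alpha)}z^{-3T(\alpha/\lambda)}$, and $c_k(q^2,z^2,w^2)$ is obtained by substituting $q^2,z^2,w^2$ for $q,z,w$. Note $c_0=a$, $b_0=a$, and $b_k,c_k$ depend only on $k$ mod $3$. *)

theory Defs
  imports Complex_Main "HOL-Library.Function_Algebras"
begin

section \<open>Eisenstein integers\<close>

definition omega :: complex where
  "omega = exp (2 * of_real pi * \<i> / 3)"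

definition lambda :: complex where
  "lambda = omega - omega\<^sup>2"

definition K :: "complex set" where
  "K = {of_rat x + of_rat y * lambda | x y. True}"

definition O_K :: "complex set" where
  "O_K = {of_int m + of_int n * omega | m n. True}"

definition T :: "complex \<Rightarrow> complex" where
  "T \<alpha> = \<alpha> + cnj \<alpha>"

text \<open>The integer \<open>a\<close> is only determined modulo 3, but \<open>omega powi a\<close> is unique; see
  \<open>chi_eqI\<close> below.\<close>

definition chi :: "complex \<Rightarrow> complex" where
  "chi \<alpha> = (THE c. \<exists>a::int. (\<exists>\<beta>\<in>O_K. \<alpha> - of_int a = lambda * \<beta>) \<and> c = omega powi a)"

definition O_coset :: "int \<Rightarrow> complex set" where
  "O_coset k = {\<alpha> + of_int k / lambda | \<alpha>. \<alpha> \<in> O_K}"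


section \<open>Formal series with rational exponents\<close>

text \<open>The triple \<open>(r, s, t)\<close> stands for the monomial \<open>q^r z^s w^t\<close>, and a formal series is its
  function of coefficients.  Addition of series is the pointwise one of
  \<^theory>\<open>HOL-Library.Function_Algebras\<close>; beware that \<open>*\<close> on functions is pointwise as
  well, so the product of series is \<open>ser_mult\<close>.\<close>

type_synonym monomial = "rat \<times> rat \<times> rat"
type_synonym series = "monomial \<Rightarrow> complex"

definition Xq :: monomial where "Xq = (1, 0, 0)"
definition Xz :: monomial where "Xz = (0, 1, 0)"
definition Xw :: monomial where "Xw = (0, 0, 1)"
definition mono_one :: monomial where "mono_one = (0, 0, 0)"

fun mono_mult :: "monomial \<Rightarrow> monomial \<Rightarrow> monomial" where
  "mono_mult (r, s, t) (r', s', t') = (r + r', s + s', t + t')"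

fun mono_pow :: "monomial \<Rightarrow> rat \<Rightarrow> monomial"  (infixr "\<up>" 80) where
  "mono_pow (r, s, t) e = (e * r, e * s, e * t)"

definition ser_smult :: "complex \<Rightarrow> series \<Rightarrow> series"  (infixr "\<odot>" 75) where
  "c \<odot> f = (\<lambda>m. c * f m)"

text \<open>The Cauchy product.  It is meaningful when every monomial arises from only finitely many
  pairs of monomials in the supports.  This is so for the products of theta series considered
  here, since the exponents of \<open>q\<close> are values of positive definite quadratic forms on lattice
  cosets.\<close>

definition ser_mult :: "series \<Rightarrow> series \<Rightarrow> series"  (infixl "\<star>" 70) where
  "f \<star> g = (\<lambda>m. \<Sum>(i, j) | f i \<noteq> 0 \<and> g j \<noteq> 0 \<and> mono_mult i j = m. f i * g j)"


section \<open>The theta series\<close>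

text \<open>The rational number equal to a given complex number; it is applied only to numbers that are
  rational, by \<open>norm_rational\<close>, \<open>T_rational\<close> and \<open>T_div_lambda_rational\<close> below.\<close>

definition the_rat :: "complex \<Rightarrow> rat" where
  "the_rat x = (THE r. of_rat r = x)"

text \<open>The monomial \<open>x^N y^S u^S'\<close> where \<open>N\<close> is the squared absolute value of \<open>\<alpha>\<close>,
  \<open>S = T \<alpha>\<close> and \<open>S' = T (\<alpha> / lambda)\<close>.\<close>

definition theta_monomial :: "monomial \<Rightarrow> monomial \<Rightarrow> monomial \<Rightarrow> complex \<Rightarrow> monomial" where
  "theta_monomial x y u \<alpha> =
     mono_mult (x \<up> the_rat (of_real ((cmod \<alpha>)\<^sup>2)))
       (mono_mult (y \<up> the_rat (T \<alpha>)) (u \<up> the_rat (T (\<alpha> / lambda))))"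

text \<open>The sum over \<open>\<alpha> \<in> I\<close> of \<open>\<psi> \<alpha>\<close> times this monomial.  The arguments \<open>x\<close>, \<open>y\<close>, \<open>u\<close> are
  the monomials substituted for the three variables of the series.\<close>

definition theta_series ::
  "complex set \<Rightarrow> (complex \<Rightarrow> complex) \<Rightarrow> monomial \<Rightarrow> monomial \<Rightarrow> monomial \<Rightarrow> series" where
  "theta_series I \<psi> x y u = (\<lambda>m. \<Sum>\<alpha> | \<alpha> \<in> I \<and> theta_monomial x y u \<alpha> = m. \<psi> \<alpha>)"

definition a3 :: "monomial \<Rightarrow> monomial \<Rightarrow> monomial \<Rightarrow> series" where
  "a3 = theta_series O_K (\<lambda>_. 1)"

definition b3 :: "int \<Rightarrow> monomial \<Rightarrow> monomial \<Rightarrow> monomial \<Rightarrow> series" where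
  "b3 k = theta_series O_K (\<lambda>\<alpha>. chi \<alpha> powi k)"

definition c3 :: "int \<Rightarrow> monomial \<Rightarrow> monomial \<Rightarrow> monomial \<Rightarrow> series" where
  "c3 k = theta_series (O_coset k) (\<lambda>_. 1)"

definition a1 :: "monomial \<Rightarrow> series" where "a1 x = a3 x mono_one mono_one"
definition b1 :: "monomial \<Rightarrow> series" where "b1 x = b3 1 x mono_one mono_one"
definition c1 :: "monomial \<Rightarrow> series" where "c1 x = c3 1 x mono_one mono_one"


section \<open>Well-definedness\<close>

lemma omega_eq: "omega = Complex (-1/2) (sqrt 3 / 2)"
proof -
  have "omega = cis (2 * pi / 3)"
    by (simp add: omega_def cis_conv_exp mult_ac)
  then show ?thesis
    by (simp add: complex_eq_iff cos_120 sin_120)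
qed

lemma lambda_eq: "lambda = Complex 0 (sqrt 3)"
  by (simp add: lambda_def omega_eq power2_eq_square complex_eq_iff)

lemma lambda_squared: "lambda * lambda = -3"
  by (simp add: lambda_eq complex_eq_iff)

lemma lambda_nonzero: "lambda \<noteq> 0"
  using lambda_squared by auto

lemma omega_conv_lambda: "omega = -1/2 + lambda / 2"
  by (simp add: omega_eq lambda_eq complex_eq_iff)

lemma omega_cubed: "omega ^ 3 = 1"
  by (simp add: omega_eq power3_eq_cube complex_eq_iff algebra_simps)

lemma div_lambda_in_K:
  assumes "\<alpha> \<in> K" shows "\<alpha> / lambda \<in> K"
proof -
  obtain x y where "\<alpha> = of_rat x + of_rat y * lambda"
    using assms by (auto simp: K_def)
  moreover have "1 / lambda = - lambda / 3"
    using lambda_nonzero lambda_squared by (simp add: field_simps)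
  ultimately have "\<alpha> / lambda = of_rat x * (- lambda / 3) + of_rat y"
    using lambda_nonzero by (metis add_divide_distrib mult.right_neutral
        nonzero_mult_div_cancel_right times_divide_eq_right)
  then have "\<alpha> / lambda = of_rat y + of_rat (- x / 3) * lambda"
    by (simp add: of_rat_divide of_rat_minus)
  then show ?thesis unfolding K_def by blast
qed

lemma O_coset_subset_K: "O_coset k \<subseteq> K"
proof
  fix \<alpha> assume "\<alpha> \<in> O_coset k"
  then obtain m n where "\<alpha> = of_int m + of_int n * omega + of_int k / lambda"
    by (auto simp: O_coset_def O_K_def)
  moreover have "1 / lambda = - lambda / 3"
    using lambda_nonzero lambda_squared by (simp add: field_simps)
  then have "of_int k / lambda = of_int k * (- lambda / 3)"
    by (metis times_divide_eq_right mult.right_neutral)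
  ultimately have "\<alpha> = of_rat (of_int m - of_int n / 2)
      + of_rat (of_int n / 2 - of_int k / 3) * lambda"
    by (simp add: omega_conv_lambda of_rat_diff of_rat_divide algebra_simps)
  then show "\<alpha> \<in> K" unfolding K_def by blast
qed

lemma O_K_subset_K: "O_K \<subseteq> K"
  using O_coset_subset_K[of 0] by (auto simp: O_coset_def)

lemma of_rat_complex_of_real: "(of_rat x :: complex) = of_real (of_rat x)"
  by (cases x) (simp add: of_rat_rat)

lemma T_rational:
  assumes "\<alpha> \<in> K" shows "of_rat (the_rat (T \<alpha>)) = T \<alpha>"
proof -
  obtain x y where "\<alpha> = of_rat x + of_rat y * lambda"
    using assms by (auto simp: K_def)
  then have "T \<alpha> = of_rat (2 * x)"
    by (simp add: T_def of_rat_complex_of_real lambda_eq complex_eq_iff of_rat_mult)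
  then show ?thesis by (auto simp: the_rat_def)
qed

lemma T_div_lambda_rational:
  "\<alpha> \<in> K \<Longrightarrow> of_rat (the_rat (T (\<alpha> / lambda))) = T (\<alpha> / lambda)"
  by (intro T_rational div_lambda_in_K)

lemma norm_rational:
  assumes "\<alpha> \<in> K"
  shows "of_rat (the_rat (of_real ((cmod \<alpha>)\<^sup>2))) = (of_real ((cmod \<alpha>)\<^sup>2) :: complex)"
proof -
  obtain x y where "\<alpha> = of_rat x + of_rat y * lambda"
    using assms by (auto simp: K_def)
  then have "of_real ((cmod \<alpha>)\<^sup>2) = (of_rat (x\<^sup>2 + 3 * y\<^sup>2) :: complex)"
    by (simp add: of_rat_complex_of_real lambda_eq cmod_power2 of_rat_add of_rat_mult
        of_rat_power power_mult_distrib)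
  then show ?thesis by (auto simp: the_rat_def)
qed

lemma O_K_eq_iff:
  "of_int m + of_int n * omega = of_int m' + of_int n' * omega \<longleftrightarrow> m = m' \<and> n = n'"
  by (auto simp: omega_eq complex_eq_iff)

lemma lambda_mult_O_K:
  "lambda * (of_int m + of_int n * omega) = of_int (m - 2 * n) + of_int (2 * m - n) * omega"
  by (simp add: omega_eq lambda_eq complex_eq_iff field_simps)

lemma chi_unique:
  assumes "\<alpha> - of_int a = lambda * \<beta>" "\<beta> \<in> O_K"
    and "\<alpha> - of_int a' = lambda * \<beta>'" "\<beta>' \<in> O_K"
  shows "omega powi a = omega powi a'"
proof -
  obtain m n where \<beta>: "\<beta> = of_int m + of_int n * omega"
    using assms(2) by (auto simp: O_K_def)
  obtain m' n' where \<beta>': "\<beta>' = of_int m' + of_int n' * omega"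
    using assms(4) by (auto simp: O_K_def)
  have "of_int a + lambda * \<beta> = of_int a' + lambda * \<beta>'"
    using assms(1,3) by (metis diff_add_cancel add.commute)
  then have "of_int (a + (m - 2 * n)) + of_int (2 * m - n) * omega
      = of_int (a' + (m' - 2 * n')) + of_int (2 * m' - n') * omega"
    unfolding \<beta> \<beta>' lambda_mult_O_K by (simp add: algebra_simps)
  then have "a + (m - 2 * n) = a' + (m' - 2 * n')" "2 * m - n = 2 * m' - n'"
    unfolding O_K_eq_iff by auto
  then have "a = a' + 3 * (m - m')"
    by (simp add: algebra_simps)
  then obtain l where "a = a' + 3 * l" by blast
  moreover have "omega \<noteq> 0" by (simp add: omega_def)
  ultimately have "omega powi a = omega powi a' * (omega powi 3) powi l"
    by (simp add: power_int_add power_int_mult)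
  also have "omega powi 3 = 1" using omega_cubed by simp
  finally show ?thesis by simp
qed

lemma chi_eqI:
  assumes "\<alpha> - of_int a = lambda * \<beta>" "\<beta> \<in> O_K"
  shows "chi \<alpha> = omega powi a"
  unfolding chi_def
proof (rule the_equality)
  show "\<exists>a'::int. (\<exists>\<beta>\<in>O_K. \<alpha> - of_int a' = lambda * \<beta>) \<and> omega powi a = omega powi a'"
    using assms by blast
qed (use assms chi_unique in blast)

lemma chi_exists:
  assumes "\<alpha> \<in> O_K"
  shows "\<exists>a::int. \<exists>\<beta>\<in>O_K. \<alpha> - of_int a = lambda * \<beta>"
proof -
  obtain m n where \<alpha>: "\<alpha> = of_int m + of_int n * omega"
    using assms by (auto simp: O_K_def)
  have "\<alpha> - of_int (m + n) = lambda * (of_int n + of_int n * omega)"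
    unfolding lambda_mult_O_K by (simp add: \<alpha> algebra_simps)
  then show ?thesis unfolding O_K_def by blast
qed

end

theory Submission
  imports Defs
begin

text \<open>Put \<open>\<gamma> = (\<alpha> + 2\<beta>) / lambda\<close> and \<open>\<delta> = (\<alpha> - \<beta>) / lambda\<close>.  Then
  \<open>|\<alpha>|\<^sup>2 + 2|\<beta>|\<^sup>2 = |\<gamma>|\<^sup>2 + 2|\<delta>|\<^sup>2\<close> and \<open>\<alpha> + 2\<beta> = lambda * \<gamma>\<close>, so the product on the left
  becomes a sum over the pairs \<open>(\<gamma>, \<delta>)\<close> in the inverse different with
  \<open>\<delta> - \<gamma> \<in> k + lambda * O_K\<close>.  The monomial depends on \<open>\<delta>\<close> only through \<open>|\<delta>|\<close>, so the sum
  is unchanged under \<open>\<delta> \<mapsto> - \<delta>\<close> and \<open>\<delta> \<mapsto> omega * \<delta>\<close>.  The pairs in \<open>O_K\<close> are sorted by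
  orthogonality of the characters \<open>chi\<close>; for those in the other two cosets the condition modulo
  \<open>lambda\<close> is removed by averaging over \<open>\<delta> \<mapsto> omega * \<delta>\<close>.\<close>

section \<open>The ring \<open>O_K\<close> and divisibility by \<open>lambda\<close>\<close>

lemma O_K_add: "x \<in> O_K \<Longrightarrow> y \<in> O_K \<Longrightarrow> x + y \<in> O_K"
proof -
  assume "x \<in> O_K" "y \<in> O_K"
  then obtain m n m' n' where "x = of_int m + of_int n * omega" "y = of_int m' + of_int n' * omega"
    by (auto simp: O_K_def)
  then have "x + y = of_int (m + m') + of_int (n + n') * omega"
    by (simp add: algebra_simps)
  then show ?thesis unfolding O_K_def by blast
qed

lemma omega_squared: "omega * omega = -1 - omega"
  by (simp add: omega_eq complex_eq_iff)

lemma O_K_mult: "x \<in> O_K \<Longrightarrow> y \<in> O_K \<Longrightarrow> x * y \<in> O_K"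
proof -
  assume "x \<in> O_K" "y \<in> O_K"
  then obtain m n m' n' where xy: "x = of_int m + of_int n * omega" "y = of_int m' + of_int n' * omega"
    by (auto simp: O_K_def)
  have "x * y = of_int m * of_int m' + (of_int m * of_int n' + of_int n * of_int m') * omega
      + of_int n * of_int n' * (omega * omega)"
    unfolding xy by algebra
  also have "\<dots> = of_int (m * m' - n * n') + of_int (m * n' + n * m' - n * n') * omega"
    by (simp add: omega_squared algebra_simps)
  finally show ?thesis unfolding O_K_def by blast
qed

lemma of_int_in_O_K [simp]: "of_int m \<in> O_K"
  unfolding O_K_def by (rule CollectI) (metis add.right_neutral mult_zero_left of_int_0)

lemma zero_in_O_K [simp]: "0 \<in> O_K" and one_in_O_K [simp]: "1 \<in> O_K"
  using of_int_in_O_K[of 0] of_int_in_O_K[of 1] by simp_all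

lemma omega_in_O_K [simp]: "omega \<in> O_K"
  unfolding O_K_def by (rule CollectI) (metis add.left_neutral mult_1 of_int_0 of_int_1)

lemma O_K_minus: "x \<in> O_K \<Longrightarrow> - x \<in> O_K"
  using O_K_mult[OF of_int_in_O_K[of "-1"], of x] by simp

lemma O_K_diff: "x \<in> O_K \<Longrightarrow> y \<in> O_K \<Longrightarrow> x - y \<in> O_K"
  using O_K_add[of x "-y"] O_K_minus[of y] by simp

lemma lambda_in_O_K [simp]: "lambda \<in> O_K"
  unfolding lambda_def power2_eq_square by (intro O_K_diff O_K_mult omega_in_O_K)

lemmas O_K_closed = O_K_add O_K_mult O_K_minus O_K_diff

text \<open>In the basis \<open>1\<close>, \<open>omega\<close> a multiple of \<open>lambda\<close>
  is \<open>(p - 2 * r) + (2 * p - r) * omega\<close>; it is an integer only for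
  \<open>r = 2 * p\<close>, and then equals \<open>-3 * p\<close>. Conversely
  \<open>3 = - lambda * lambda\<close>.\<close>

lemma of_int_lambda_dvd_iff: "(\<exists>\<beta>\<in>O_K. of_int n = lambda * \<beta>) \<longleftrightarrow> 3 dvd n"
proof
  assume "\<exists>\<beta>\<in>O_K. of_int n = lambda * \<beta>"
  then obtain p r where "of_int n = lambda * (of_int p + of_int r * omega)"
    by (auto simp: O_K_def)
  then have "of_int n + of_int 0 * omega = of_int (p - 2 * r) + of_int (2 * p - r) * omega"
    unfolding lambda_mult_O_K by simp
  then have "n = p - 2 * r" "0 = 2 * p - r"
    unfolding O_K_eq_iff by auto
  then have "n = 3 * (- p)" by simp
  then show "3 dvd n" by (rule dvdI)
next
  assume "3 dvd n"
  then obtain l where l: "n = 3 * l" by blast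
  have "lambda * (- (lambda * of_int l)) = - ((lambda * lambda) * of_int l)" by algebra
  also have "\<dots> = of_int n"
    unfolding lambda_squared l by simp
  finally show "\<exists>\<beta>\<in>O_K. of_int n = lambda * \<beta>"
    by (intro bexI[of _ "- (lambda * of_int l)"]) (auto intro!: O_K_closed)
qed

section \<open>The inverse different and its residues modulo \<open>lambda\<close>\<close>

text \<open>This is the dual lattice of \<open>O_K\<close> for the trace form. It is the union of
  the cosets \<open>O_coset k\<close> for \<open>k = 0, 1, -1\<close>, so every series in the
  identity is a sum over a subset of it.\<close>

definition inv_different :: "complex set" where
  "inv_different = {\<alpha>. lambda * \<alpha> \<in> O_K}"

text \<open>Residue classes of the inverse different modulo \<open>lambda\<close>: the pair \<open>(c, j)\<close>, taken
  modulo 3 in both entries, is a complete invariant.\<close>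

definition has_residue :: "complex \<Rightarrow> int \<Rightarrow> int \<Rightarrow> bool" where
  "has_residue \<alpha> c j \<longleftrightarrow> (\<exists>\<beta>\<in>O_K. \<alpha> = of_int c + of_int j / lambda + lambda * \<beta>)"

lemma has_residueE:
  assumes "has_residue \<alpha> c j"
  obtains \<beta> where "\<beta> \<in> O_K" "\<alpha> = of_int c + of_int j / lambda + lambda * \<beta>"
  using assms by (auto simp: has_residue_def)

text \<open>The numbers \<open>j\<close> and \<open>c\<close> are the first two digits of
  \<open>lambda * \<alpha>\<close> in base \<open>lambda\<close>; each comes from one reduction
  modulo \<open>lambda\<close>, the second applied to the quotient left by the first.\<close>

lemma inv_different_has_residue:
  assumes "\<alpha> \<in> inv_different" obtains c j where "has_residue \<alpha> c j"
proof -
  from assms have "lambda * \<alpha> \<in> O_K" by (simp add: inv_different_def)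
  from chi_exists[OF this] obtain j \<beta> where \<beta>: "\<beta> \<in> O_K" "lambda * \<alpha> - of_int j = lambda * \<beta>"
    by blast
  from chi_exists[OF \<beta>(1)] obtain c \<beta>' where \<beta>': "\<beta>' \<in> O_K" "\<beta> - of_int c = lambda * \<beta>'"
    by blast
  have "\<alpha> = of_int j / lambda + \<beta>"
    using \<beta>(2) lambda_nonzero by (simp add: field_simps)
  also have "\<dots> = of_int c + of_int j / lambda + lambda * \<beta>'"
    using \<beta>'(2) by (simp add: algebra_simps)
  finally show ?thesis
    using that \<beta>'(1) unfolding has_residue_def by blast
qed

lemma has_residue_diff:
  assumes "has_residue \<alpha> c j" "has_residue \<alpha>' c' j'"
  shows "has_residue (\<alpha> - \<alpha>') (c - c') (j - j')"
proof -
  obtain \<beta> \<beta>' where *: "\<beta> \<in> O_K" "\<alpha> = of_int c + of_int j / lambda + lambda * \<beta>"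
    "\<beta>' \<in> O_K" "\<alpha>' = of_int c' + of_int j' / lambda + lambda * \<beta>'"
    using assms by (auto simp: has_residue_def)
  then have "\<alpha> - \<alpha>' = of_int (c - c') + of_int (j - j') / lambda + lambda * (\<beta> - \<beta>')"
    by (simp add: algebra_simps diff_divide_distrib)
  with * show ?thesis unfolding has_residue_def by (blast intro: O_K_diff)
qed

lemma has_residue_zero: "has_residue 0 0 0"
  unfolding has_residue_def by (rule bexI[of _ 0]) auto

lemma has_residue_minus: "has_residue \<alpha> c j \<Longrightarrow> has_residue (- \<alpha>) (- c) (- j)"
  using has_residue_diff[OF has_residue_zero] by fastforce

text \<open>Modulo \<open>lambda\<close>, \<open>omega\<close> is 1, but
  \<open>omega / lambda\<close> is \<open>1 / lambda - 1\<close>. So multiplication by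
  \<open>omega\<close> keeps the coset of \<open>O_K\<close> and shifts \<open>c\<close> by
  \<open>- j\<close>, which is a genuine rotation when 3 does not divide \<open>j\<close>.\<close>

lemma has_residue_omega_mult:
  assumes "has_residue \<alpha> c j" shows "has_residue (omega * \<alpha>) (c - j) j"
proof -
  obtain \<beta> where \<beta>: "\<beta> \<in> O_K" "\<alpha> = of_int c + of_int j / lambda + lambda * \<beta>"
    using assms by (rule has_residueE)
  have 1: "omega - 1 = lambda * (1 + omega)"
    using omega_squared by (simp add: lambda_def power2_eq_square algebra_simps)
  \<comment> \<open>The expansion of \<open>omega / lambda\<close> is checked after multiplying by
    \<open>lambda\<close>, where \<open>lambda * lambda = -3\<close> leaves an identity linear in
    \<open>lambda\<close>.\<close>
  have "(1 / lambda - 1 + lambda * (- omega)) * lambda = 1 - lambda - lambda * lambda * omega"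
    using lambda_nonzero by (simp add: algebra_simps)
  also have "\<dots> = omega"
    unfolding lambda_squared by (simp add: omega_conv_lambda)
  finally have 2: "omega / lambda = 1 / lambda - 1 + lambda * (- omega)"
    using lambda_nonzero by (metis nonzero_mult_div_cancel_right)
  have "omega * \<alpha> = of_int c + (omega - 1) * of_int c + of_int j * (omega / lambda) + lambda * (omega * \<beta>)"
    unfolding \<beta>(2) by (simp add: algebra_simps)
  also have "\<dots> = of_int (c - j) + of_int j / lambda
      + lambda * ((1 + omega) * of_int c - of_int j * omega + omega * \<beta>)"
    unfolding 1 2 by (simp add: algebra_simps)
  finally show ?thesis
    unfolding has_residue_def
    by (rule bexI) (auto intro!: O_K_closed \<beta>)
qed

lemma three_div_lambda: "3 * x / lambda = - (lambda * x)"
proof -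
  have "3 * x = - (lambda * x) * lambda"
    using lambda_squared by algebra
  then show ?thesis using lambda_nonzero by (simp add: field_simps)
qed

text \<open>The digits vanish one after the other: multiplying by \<open>lambda\<close> gives that
  \<open>lambda\<close> divides \<open>j\<close>, hence 3 does; then \<open>j / lambda\<close> is
  itself a multiple of \<open>lambda\<close>, so \<open>lambda\<close> divides \<open>c\<close>
  too.\<close>

lemma has_residue_zero_iff: "has_residue 0 c j \<longleftrightarrow> 3 dvd c \<and> 3 dvd j"
proof
  assume "has_residue 0 c j"
  then obtain \<beta> where \<beta>: "\<beta> \<in> O_K" "0 = of_int c + of_int j / lambda + lambda * \<beta>"
    by (rule has_residueE)
  have "of_int j = lambda * (- (of_int c + lambda * \<beta>))"
    using \<beta>(2) lambda_nonzero by (simp add: field_simps) algebra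
  then have j: "3 dvd j"
    unfolding of_int_lambda_dvd_iff[symmetric] by (rule bexI) (auto intro!: O_K_closed \<beta>)
  then obtain l where l: "j = 3 * l" by blast
  have "of_int j / lambda = - (lambda * of_int l)"
    by (simp add: l three_div_lambda)
  then have "of_int c = lambda * (of_int l - \<beta>)"
    using \<beta>(2) by (simp add: algebra_simps)
  then have "3 dvd c"
    unfolding of_int_lambda_dvd_iff[symmetric] by (rule bexI) (auto intro!: O_K_closed \<beta>)
  with j show "3 dvd c \<and> 3 dvd j" by simp
next
  assume "3 dvd c \<and> 3 dvd j"
  then obtain \<beta> l where *: "\<beta> \<in> O_K" "of_int c = lambda * \<beta>" "j = 3 * l"
    using of_int_lambda_dvd_iff[of c] by blast
  have "of_int j / lambda = - (lambda * of_int l)"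
    by (simp add: * three_div_lambda)
  then have "0 = of_int c + of_int j / lambda + lambda * (of_int l - \<beta>)"
    unfolding *(2) by (simp add: algebra_simps)
  then show "has_residue 0 c j"
    unfolding has_residue_def by (rule bexI) (auto intro!: O_K_closed *)
qed

lemma has_residue_iff:
  assumes "has_residue \<alpha> c j"
  shows "has_residue \<alpha> c' j' \<longleftrightarrow> 3 dvd c - c' \<and> 3 dvd j - j'"
proof
  show "has_residue \<alpha> c' j' \<Longrightarrow> 3 dvd c - c' \<and> 3 dvd j - j'"
    using has_residue_diff[OF assms] by (fastforce simp: has_residue_zero_iff)
  assume "3 dvd c - c' \<and> 3 dvd j - j'"
  then show "has_residue \<alpha> c' j'"
    using has_residue_diff[OF assms, of 0 "c - c'" "j - j'"] by (simp add: has_residue_zero_iff)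
qed

text \<open>The coset of \<open>O_K\<close> is the digit \<open>j\<close> alone: an element of
  \<open>O_K\<close> is an integer modulo \<open>lambda\<close> and so affects only
  \<open>c\<close>.\<close>

lemma O_coset_iff_has_residue:
  assumes "has_residue \<alpha> c j"
  shows "\<alpha> \<in> O_coset k \<longleftrightarrow> 3 dvd j - k"
proof
  assume "\<alpha> \<in> O_coset k"
  then obtain x where x: "x \<in> O_K" "\<alpha> = x + of_int k / lambda" by (auto simp: O_coset_def)
  from chi_exists[OF x(1)] obtain a \<beta> where "\<beta> \<in> O_K" "x - of_int a = lambda * \<beta>" by blast
  then have "has_residue \<alpha> a k"
    unfolding has_residue_def x(2) by (auto simp: algebra_simps)
  then show "3 dvd j - k" using has_residue_iff[OF assms] by simp
next
  assume "3 dvd j - k"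
  then have "has_residue \<alpha> c k" using has_residue_iff[OF assms] by simp
  then obtain \<beta> where \<beta>: "\<beta> \<in> O_K" "\<alpha> = of_int c + of_int k / lambda + lambda * \<beta>"
    by (rule has_residueE)
  then have "\<alpha> = (of_int c + lambda * \<beta>) + of_int k / lambda" "of_int c + lambda * \<beta> \<in> O_K"
    by (auto intro!: O_K_closed)
  then show "\<alpha> \<in> O_coset k" unfolding O_coset_def by blast
qed

lemma O_coset_zero: "O_coset 0 = O_K"
  by (auto simp: O_coset_def)

lemma O_K_iff_has_residue: "has_residue \<alpha> c j \<Longrightarrow> \<alpha> \<in> O_K \<longleftrightarrow> 3 dvd j"
  using O_coset_iff_has_residue[of \<alpha> c j 0] by (simp add: O_coset_zero)

lemma chi_has_residue:
  assumes "has_residue \<alpha> c j" "\<alpha> \<in> O_K" shows "chi \<alpha> = omega powi c"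
proof -
  have "has_residue \<alpha> c 0"
    using assms has_residue_iff[OF assms(1)] O_K_iff_has_residue[OF assms(1)] by simp
  then obtain \<beta> where "\<beta> \<in> O_K" "\<alpha> = of_int c + lambda * \<beta>"
    by (auto elim!: has_residueE)
  then show ?thesis by (intro chi_eqI[of _ _ \<beta>]) auto
qed

lemma inv_different_conv: "\<alpha> \<in> inv_different \<longleftrightarrow> (\<exists>x\<in>O_K. \<alpha> = x / lambda)"
proof
  assume "\<alpha> \<in> inv_different"
  then show "\<exists>x\<in>O_K. \<alpha> = x / lambda"
    using lambda_nonzero by (intro bexI[of _ "lambda * \<alpha>"]) (auto simp: inv_different_def)
qed (use lambda_nonzero in \<open>auto simp: inv_different_def\<close>)

lemma inv_different_subset_K: "inv_different \<subseteq> K"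
  using subsetD[OF O_K_subset_K] div_lambda_in_K by (auto simp: inv_different_conv)

lemma O_K_subset_inv_different: "O_K \<subseteq> inv_different"
  by (auto simp: inv_different_def intro: O_K_closed)

lemma O_coset_subset_inv_different: "O_coset k \<subseteq> inv_different"
proof
  fix \<alpha> assume "\<alpha> \<in> O_coset k"
  then obtain x where "x \<in> O_K" "\<alpha> = x + of_int k / lambda" by (auto simp: O_coset_def)
  then have "lambda * \<alpha> = lambda * x + of_int k" "lambda * x + of_int k \<in> O_K"
    using lambda_nonzero by (simp_all add: distrib_left O_K_closed)
  then show "\<alpha> \<in> inv_different" by (simp add: inv_different_def)
qed

lemma inv_different_mult: "x \<in> O_K \<Longrightarrow> \<alpha> \<in> inv_different \<Longrightarrow> x * \<alpha> \<in> inv_different"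
  unfolding inv_different_def by (auto simp: mult.left_commute[of lambda] intro: O_K_mult)

lemma inv_different_diff: "\<alpha> \<in> inv_different \<Longrightarrow> \<beta> \<in> inv_different \<Longrightarrow> \<alpha> - \<beta> \<in> inv_different"
  unfolding inv_different_def by (auto simp: right_diff_distrib intro: O_K_diff)

section \<open>Finiteness of lattice points of bounded norm\<close>

text \<open>The norm of \<open>m + n * omega\<close> is \<open>m * m - m * n + n * n\<close>.
  Completing the square in either variable shows that 4 times the norm bounds both
  \<open>m * m\<close> and \<open>n * n\<close>; with the crude estimate
  \<open>\<bar>l\<bar> \<le> l * l\<close> it bounds \<open>m\<close> and \<open>n\<close>
  themselves.\<close>

lemma finite_O_K_bounded: "finite {x \<in> O_K. (cmod x)\<^sup>2 \<le> B}"
proof -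
  define M where "M = \<lceil>4 * B\<rceil>"
  have "x \<in> (\<lambda>(m, n). of_int m + of_int n * omega) ` ({-M..M} \<times> {-M..M})"
    if x: "x \<in> O_K" "(cmod x)\<^sup>2 \<le> B" for x
  proof -
    obtain m n where mn: "x = of_int m + of_int n * omega"
      using x(1) by (auto simp: O_K_def)
    have re_im: "Re x = of_int m - of_int n / 2" "Im x = of_int n * (sqrt 3 / 2)"
      by (simp_all add: mn omega_eq)
    have norm: "(cmod x)\<^sup>2 = of_int (m * m - m * n + n * n)"
      unfolding cmod_power2 re_im by (simp add: power_mult_distrib power_divide power2_eq_square algebra_simps)
    have bound: "\<bar>l\<bar> \<le> M" if "l * l \<le> 4 * (m * m - m * n + n * n)" for l :: int
    proof -
      have "\<bar>l\<bar> \<le> l * l"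
        by (cases "l = 0") (use mult_left_mono[of 1 "\<bar>l\<bar>" "\<bar>l\<bar>"] in auto)
      with that have "\<bar>l\<bar> \<le> 4 * (m * m - m * n + n * n)" by linarith
      then have "real_of_int \<bar>l\<bar> \<le> of_int (4 * (m * m - m * n + n * n))"
        by (rule of_int_le_iff[THEN iffD2])
      also have "\<dots> = 4 * (cmod x)\<^sup>2" unfolding norm by simp
      also have "\<dots> \<le> 4 * B" using x(2) by simp
      finally show ?thesis unfolding M_def by linarith
    qed
    have "4 * (m * m - m * n + n * n) = (2 * m - n) * (2 * m - n) + 3 * (n * n)"
      "4 * (m * m - m * n + n * n) = (2 * n - m) * (2 * n - m) + 3 * (m * m)"
      by (simp_all add: algebra_simps)
    moreover have "0 \<le> (2 * m - n) * (2 * m - n)" "0 \<le> (2 * n - m) * (2 * n - m)" "0 \<le> n * n" "0 \<le> m * m"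
      by (rule zero_le_square)+
    ultimately have "\<bar>m\<bar> \<le> M" "\<bar>n\<bar> \<le> M" by (intro bound; linarith)+
    then show ?thesis unfolding mn by (intro image_eqI[of _ _ "(m, n)"]) auto
  qed
  then have "{x \<in> O_K. (cmod x)\<^sup>2 \<le> B} \<subseteq>
      (\<lambda>(m, n). of_int m + of_int n * omega) ` ({-M..M} \<times> {-M..M})"
    by blast
  then show ?thesis
    by (rule finite_subset) (intro finite_imageI finite_cartesian_product finite_atLeastAtMost_int)
qed

lemma finite_inv_different_bounded: "finite {\<alpha> \<in> inv_different. (cmod \<alpha>)\<^sup>2 \<le> B}"
proof (rule finite_subset)
  have "(cmod lambda)\<^sup>2 = 3"
    by (simp add: lambda_eq cmod_power2)
  then show "{\<alpha> \<in> inv_different. (cmod \<alpha>)\<^sup>2 \<le> B} \<subseteq> (\<lambda>x. x / lambda) ` {x \<in> O_K. (cmod x)\<^sup>2 \<le> 3 * B}"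
    by (auto simp: inv_different_conv norm_divide power_divide)
qed (intro finite_imageI finite_O_K_bounded)

section \<open>Products of theta series\<close>

text \<open>The Cauchy product runs over pairs of monomials with nonzero coefficients. Finiteness of
  the index pairs above \<open>m\<close> permits regrouping it into a sum over pairs of lattice
  points.\<close>

lemma theta_series_mult:
  fixes x y u x' y' u' :: monomial
  defines "f \<equiv> theta_monomial x y u" and "g \<equiv> theta_monomial x' y' u'"
  assumes fin: "finite {(\<alpha>, \<beta>) \<in> I \<times> J. mono_mult (f \<alpha>) (g \<beta>) = m}"
  shows "(theta_series I \<psi> x y u \<star> theta_series J \<phi> x' y' u') m
    = (\<Sum>(\<alpha>, \<beta>) | (\<alpha>, \<beta>) \<in> I \<times> J \<and> mono_mult (f \<alpha>) (g \<beta>) = m. \<psi> \<alpha> * \<phi> \<beta>)"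
proof -
  define P where "P = {(\<alpha>, \<beta>) \<in> I \<times> J. mono_mult (f \<alpha>) (g \<beta>) = m}"
  define F where "F = theta_series I \<psi> x y u"
  define G where "G = theta_series J \<phi> x' y' u'"
  define D where "D = {(i, j). F i \<noteq> 0 \<and> G j \<noteq> 0 \<and> mono_mult i j = m}"
  have F: "F i = sum \<psi> {\<alpha> \<in> I. f \<alpha> = i}" and G: "G i = sum \<phi> {\<beta> \<in> J. g \<beta> = i}" for i
    by (simp_all add: F_def G_def theta_series_def f_def g_def)
  have "finite P" using fin by (simp add: P_def)
  have "(F \<star> G) m = (\<Sum>(i, j)\<in>D. F i * G j)"
    by (simp add: ser_mult_def D_def)
  \<comment> \<open>A pair of monomials coming from \<open>P\<close> can be missing from
    \<open>D\<close> when the terms of a coefficient cancel; including it adds zero.\<close>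
  also have "\<dots> = (\<Sum>(i, j)\<in>map_prod f g ` P. F i * G j)"
  proof (rule sum.mono_neutral_left)
    show "D \<subseteq> map_prod f g ` P"
    proof (clarify)
      fix r s t r' s' t' assume "((r, s, t), (r', s', t')) \<in> D"
      then have nz: "F (r, s, t) \<noteq> 0" "G (r', s', t') \<noteq> 0"
        and m: "mono_mult (r, s, t) (r', s', t') = m"
        by (auto simp: D_def)
      from nz(1) obtain \<alpha> where "\<alpha> \<in> I" "f \<alpha> = (r, s, t)"
        unfolding F by (metis (mono_tags, lifting) Collect_empty_eq sum.empty)
      moreover from nz(2) obtain \<beta> where "\<beta> \<in> J" "g \<beta> = (r', s', t')"
        unfolding G by (metis (mono_tags, lifting) Collect_empty_eq sum.empty)
      ultimately show "((r, s, t), (r', s', t')) \<in> map_prod f g ` P"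
        using m by (intro image_eqI[of _ _ "(\<alpha>, \<beta>)"]) (auto simp: P_def)
    qed
  next
    show "\<forall>p\<in>map_prod f g ` P - D. (case p of (i, j) \<Rightarrow> F i * G j) = 0"
      by (auto simp: D_def P_def)
  qed (simp add: \<open>finite P\<close>)
  also have "\<dots> = (\<Sum>p\<in>map_prod f g ` P. \<Sum>q | q \<in> P \<and> map_prod f g q = p. \<psi> (fst q) * \<phi> (snd q))"
  proof (rule sum.cong[OF refl])
    fix p assume "p \<in> map_prod f g ` P"
    then obtain \<alpha> \<beta> where "p = (f \<alpha>, g \<beta>)" "mono_mult (f \<alpha>) (g \<beta>) = m"
      unfolding P_def by auto
    then obtain i j where p: "p = (i, j)" "mono_mult i j = m" by blast
    have "F i * G j = (\<Sum>q\<in>{\<alpha> \<in> I. f \<alpha> = i} \<times> {\<beta> \<in> J. g \<beta> = j}. \<psi> (fst q) * \<phi> (snd q))"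
      unfolding F G sum_product sum.cartesian_product by (simp add: case_prod_unfold)
    \<comment> \<open>Since \<open>i\<close> and \<open>j\<close> multiply to \<open>m\<close>,
      every pair of points above \<open>(i, j)\<close> already lies in \<open>P\<close>.\<close>
    also have "{\<alpha> \<in> I. f \<alpha> = i} \<times> {\<beta> \<in> J. g \<beta> = j} = {q \<in> P. map_prod f g q = p}"
      using p by (auto simp: P_def)
    finally show "(case p of (i, j) \<Rightarrow> F i * G j)
        = (\<Sum>q | q \<in> P \<and> map_prod f g q = p. \<psi> (fst q) * \<phi> (snd q))"
      by (simp add: p)
  qed
  also have "\<dots> = (\<Sum>q\<in>P. \<psi> (fst q) * \<phi> (snd q))"
    by (rule sum.image_gen[OF \<open>finite P\<close>, symmetric])
  finally show ?thesis
    unfolding F_def G_def P_def by (simp add: case_prod_unfold)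
qed

section \<open>Rational exponents and the change of variables\<close>

definition rat_norm :: "complex \<Rightarrow> rat" where
  "rat_norm \<alpha> = the_rat (of_real ((cmod \<alpha>)\<^sup>2))"

definition rat_trace :: "complex \<Rightarrow> rat" where
  "rat_trace \<alpha> = the_rat (T \<alpha>)"

lemma theta_monomial_conv:
  "theta_monomial (r, s, t) (r', s', t') (r'', s'', t'') \<alpha> =
    (rat_norm \<alpha> * r + rat_trace \<alpha> * r' + rat_trace (\<alpha> / lambda) * r'',
     rat_norm \<alpha> * s + rat_trace \<alpha> * s' + rat_trace (\<alpha> / lambda) * s'',
     rat_norm \<alpha> * t + rat_trace \<alpha> * t' + rat_trace (\<alpha> / lambda) * t'')"
  by (simp add: theta_monomial_def rat_norm_def rat_trace_def)

text \<open>With the norm written as a product, comparing exponents of \<open>q\<close> becomes a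
  polynomial identity in the numbers and their conjugates.\<close>

lemma of_rat_norm: "\<alpha> \<in> K \<Longrightarrow> of_rat (rat_norm \<alpha>) = \<alpha> * cnj \<alpha>"
  by (metis norm_rational rat_norm_def complex_norm_square)

lemma of_rat_norm_real: "\<alpha> \<in> K \<Longrightarrow> of_rat (rat_norm \<alpha>) = (cmod \<alpha>)\<^sup>2"
  using norm_rational[of \<alpha>] unfolding rat_norm_def of_rat_complex_of_real of_real_eq_iff .

lemma of_rat_trace: "\<alpha> \<in> K \<Longrightarrow> of_rat (rat_trace \<alpha>) = \<alpha> + cnj \<alpha>"
  using T_rational[of \<alpha>] by (simp add: rat_trace_def T_def)

text \<open>The zeros in the monomials leave only the norms in the exponent of \<open>q\<close>,
  which is \<open>d\<close> times one norm plus \<open>d'\<close> times the other. Both terms are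
  nonnegative, so fixing the exponent bounds both norms.\<close>

lemma finite_mult_pairs:
  assumes "0 < d" "0 < d'"
  shows "finite {(\<alpha>, \<beta>) \<in> inv_different \<times> inv_different.
    mono_mult (theta_monomial (d, s, t) (0, s', t') (0, s'', t'') \<alpha>)
      (theta_monomial (d', r, q) (0, r', q') (0, r'', q'') \<beta>) = m}" (is "finite ?A")
proof -
  obtain e e' e'' where m: "m = (e, e', e'')" by (cases m)
  let ?B = "\<lambda>c. {\<alpha> \<in> inv_different. (cmod \<alpha>)\<^sup>2 \<le> of_rat (e / c)}"
  have "?A \<subseteq> ?B d \<times> ?B d'"
  proof (rule subrelI)
    fix \<alpha> \<beta> assume "(\<alpha>, \<beta>) \<in> ?A"
    then have L: "\<alpha> \<in> inv_different" "\<beta> \<in> inv_different"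
      and eq: "mono_mult (theta_monomial (d, s, t) (0, s', t') (0, s'', t'') \<alpha>)
        (theta_monomial (d', r, q) (0, r', q') (0, r'', q'') \<beta>) = m"
      by auto
    have e: "rat_norm \<alpha> * d + rat_norm \<beta> * d' = e"
      using eq by (simp add: theta_monomial_conv m)
    have norm: "of_rat (rat_norm \<alpha>) = (cmod \<alpha>)\<^sup>2" "of_rat (rat_norm \<beta>) = (cmod \<beta>)\<^sup>2"
      using L inv_different_subset_K by (auto intro: of_rat_norm_real)
    have "0 \<le> (of_rat (rat_norm \<alpha>) :: real)" "0 \<le> (of_rat (rat_norm \<beta>) :: real)"
      unfolding norm by simp_all
    then have "0 \<le> rat_norm \<alpha> * d" "0 \<le> rat_norm \<beta> * d'"
      using assms by simp_all
    then have "rat_norm \<alpha> \<le> e / d" "rat_norm \<beta> \<le> e / d'"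
      using e assms by (auto simp: field_simps)
    then show "(\<alpha>, \<beta>) \<in> ?B d \<times> ?B d'"
      using L by (auto simp: norm[symmetric] of_rat_less_eq)
  qed
  then show ?thesis
    by (rule finite_subset) (intro finite_cartesian_product finite_inv_different_bounded)
qed

text \<open>Put \<open>\<alpha> = \<beta> + lambda * \<delta>\<close> and
  \<open>\<gamma> = \<delta> - lambda * \<beta>\<close>. Then
  \<open>\<alpha> + 2 * \<beta> = lambda * \<gamma>\<close>, and
  \<open>lambda * \<gamma> = -3 * (\<gamma> / lambda)\<close>: this exchanges the roles of
  \<open>z\<close> and \<open>w\<close> and produces the exponent -3. Both sums of norms equal
  \<open>3 * |\<beta>|^2 + 3 * |\<delta>|^2 + T (lambda * \<delta> * cnj \<beta>)\<close>.\<close>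

lemma monomial_transform:
  assumes K: "\<beta> \<in> K" "\<delta> \<in> K" "\<beta> + lambda * \<delta> \<in> K" "\<delta> - lambda * \<beta> \<in> K"
  shows "mono_mult (theta_monomial Xq Xz Xw (\<beta> + lambda * \<delta>))
      (theta_monomial (Xq \<up> 2) (Xz \<up> 2) (Xw \<up> 2) \<beta>)
    = mono_mult (theta_monomial Xq Xw (Xz \<up> (-3)) (\<delta> - lambda * \<beta>))
      (theta_monomial (Xq \<up> 2) mono_one mono_one \<delta>)"
proof -
  have cl: "cnj lambda = - lambda" by (simp add: lambda_eq complex_eq_iff)
  note simps = K div_lambda_in_K of_rat_norm of_rat_trace of_rat_add of_rat_mult of_rat_minus cl
  have div: "x / lambda = - (lambda * x) / 3" for x
    using three_div_lambda[of x] by (simp add: field_simps)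
  have "(of_rat (rat_norm (\<beta> + lambda * \<delta>) + rat_norm \<beta> * 2) :: complex)
      = of_rat (rat_norm (\<delta> - lambda * \<beta>) + rat_norm \<delta> * 2)"
    using lambda_squared by (simp add: simps) algebra
  moreover have "(of_rat (rat_trace (\<beta> + lambda * \<delta>) + rat_trace \<beta> * 2) :: complex)
      = of_rat (rat_trace ((\<delta> - lambda * \<beta>) / lambda) * (-3))"
    using lambda_squared by (simp add: simps) (simp add: div field_simps, algebra)
  moreover have "(of_rat (rat_trace ((\<beta> + lambda * \<delta>) / lambda) + rat_trace (\<beta> / lambda) * 2) :: complex)
      = of_rat (rat_trace (\<delta> - lambda * \<beta>))"
    using lambda_squared by (simp add: simps) (simp add: div field_simps, algebra)
  ultimately show ?thesis
    unfolding of_rat_eq_iff by (simp add: theta_monomial_conv Xq_def Xz_def Xw_def mono_one_def)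
qed

section \<open>Cube roots of unity\<close>

lemma omega_nonzero: "omega \<noteq> 0"
  by (simp add: omega_def)

lemma omega_powi_mod: "omega powi n = omega powi (n mod 3)"
proof -
  have "omega powi n = omega powi (3 * (n div 3) + n mod 3)" by simp
  also have "\<dots> = (omega powi 3) powi (n div 3) * omega powi (n mod 3)"
    using omega_nonzero by (simp only: power_int_add power_int_mult simp_thms)
  also have "omega powi 3 = 1" using omega_cubed by simp
  finally show ?thesis by simp
qed

lemma omega_powi_sum: "1 + omega powi n + omega powi (- n) = 3 * of_bool (3 dvd n)"
proof -
  consider "n mod 3 = 0" "(- n) mod 3 = 0" | "n mod 3 = 1" "(- n) mod 3 = 2" | "n mod 3 = 2" "(- n) mod 3 = 1"
    by atomize_elim presburger
  then show ?thesis
  proof cases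
    case 1
    then show ?thesis by (simp add: omega_powi_mod[of n] omega_powi_mod[of "- n"] dvd_eq_mod_eq_0)
  next
    case 2
    then show ?thesis
      by (simp add: omega_powi_mod[of n] omega_powi_mod[of "- n"] dvd_eq_mod_eq_0 omega_squared power2_eq_square)
  next
    case 3
    then show ?thesis
      by (simp add: omega_powi_mod[of n] omega_powi_mod[of "- n"] dvd_eq_mod_eq_0 omega_squared power2_eq_square)
  qed
qed

section \<open>Both sides as sums over pairs\<close>

text \<open>Taking all pairs of the inverse different gives one finite index set for every product
  in the identity; the individual cosets enter only through indicator weights.\<close>

definition theta_pairs :: "monomial \<Rightarrow> (complex \<times> complex) set" where
  "theta_pairs m = {(\<gamma>, \<delta>) \<in> inv_different \<times> inv_different.
    mono_mult (theta_monomial Xq Xw (Xz \<up> (-3)) \<gamma>) (theta_monomial (Xq \<up> 2) mono_one mono_one \<delta>) = m}"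

lemma finite_theta_pairs: "finite (theta_pairs m)"
  unfolding theta_pairs_def Xq_def Xz_def Xw_def mono_one_def mono_pow.simps
  using finite_mult_pairs[of 1 2] by simp

lemma theta_series_mult_theta_pairs:
  assumes "I \<subseteq> inv_different" "J \<subseteq> inv_different"
  shows "(theta_series I \<psi> Xq Xw (Xz \<up> (-3)) \<star> theta_series J \<phi> (Xq \<up> 2) mono_one mono_one) m
    = (\<Sum>(\<gamma>, \<delta>)\<in>theta_pairs m. of_bool (\<gamma> \<in> I \<and> \<delta> \<in> J) * (\<psi> \<gamma> * \<phi> \<delta>))"
proof -
  let ?P = "{(\<gamma>, \<delta>) \<in> I \<times> J.
    mono_mult (theta_monomial Xq Xw (Xz \<up> (-3)) \<gamma>) (theta_monomial (Xq \<up> 2) mono_one mono_one \<delta>) = m}"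
  have sub: "?P \<subseteq> theta_pairs m"
    using assms by (auto simp: theta_pairs_def)
  show ?thesis
    unfolding theta_series_mult[OF finite_subset[OF sub finite_theta_pairs]]
    by (rule sum.mono_neutral_cong_left[OF finite_theta_pairs sub]) (auto simp: theta_pairs_def)
qed

text \<open>For \<open>\<delta> = (\<alpha> - \<beta>) / lambda\<close> and
  \<open>\<gamma> = \<delta> - lambda * \<beta>\<close>, the points \<open>\<alpha>\<close> and
  \<open>\<beta>\<close> share a coset of \<open>O_K\<close> exactly when \<open>\<delta>\<close> is
  in the inverse different, and \<open>\<beta>\<close> lies in \<open>O_coset k\<close> exactly when
  \<open>\<delta> - \<gamma> = lambda * \<beta>\<close> lies in
  \<open>k + lambda * O_K\<close>.\<close>

lemma c3_mult_theta_pairs: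
  "(c3 k Xq Xz Xw \<star> c3 k (Xq \<up> 2) (Xz \<up> 2) (Xw \<up> 2)) m
    = (\<Sum>(\<gamma>, \<delta>)\<in>theta_pairs m. of_bool (has_residue (\<delta> - \<gamma>) k 0))"
proof -
  let ?l = "\<lambda>\<alpha> \<beta>. mono_mult (theta_monomial Xq Xz Xw \<alpha>)
      (theta_monomial (Xq \<up> 2) (Xz \<up> 2) (Xw \<up> 2) \<beta>)"
  let ?r = "\<lambda>\<gamma> \<delta>. mono_mult (theta_monomial Xq Xw (Xz \<up> (-3)) \<gamma>)
      (theta_monomial (Xq \<up> 2) mono_one mono_one \<delta>)"
  let ?Q = "{(\<alpha>, \<beta>) \<in> O_coset k \<times> O_coset k. ?l \<alpha> \<beta> = m}"
  let ?R = "{(\<gamma>, \<delta>) \<in> theta_pairs m. has_residue (\<delta> - \<gamma>) k 0}"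
  have "finite {(\<alpha>, \<beta>) \<in> inv_different \<times> inv_different. ?l \<alpha> \<beta> = m}"
    unfolding Xq_def Xz_def Xw_def mono_one_def mono_pow.simps
    using finite_mult_pairs[of 1 2] by simp
  then have "finite ?Q"
    by (rule finite_subset[rotated]) (use O_coset_subset_inv_different in auto)
  from theta_series_mult[OF this, of "\<lambda>_. 1" "\<lambda>_. 1"]
  have "(c3 k Xq Xz Xw \<star> c3 k (Xq \<up> 2) (Xz \<up> 2) (Xw \<up> 2)) m = (\<Sum>_\<in>?Q. 1)"
    by (simp add: c3_def case_prod_unfold)
  also have "\<dots> = (\<Sum>_\<in>?R. 1)"
  proof (rule sum.reindex_bij_witness[where
        j = "\<lambda>(\<alpha>, \<beta>). ((\<alpha> - \<beta>) / lambda - lambda * \<beta>, (\<alpha> - \<beta>) / lambda)" and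
        i = "\<lambda>(\<gamma>, \<delta>). ((\<delta> - \<gamma>) / lambda + lambda * \<delta>, (\<delta> - \<gamma>) / lambda)"])
    fix p assume "p \<in> ?Q"
    then obtain \<alpha> \<beta> where p: "p = (\<alpha>, \<beta>)" "\<alpha> \<in> O_coset k" "\<beta> \<in> O_coset k" "?l \<alpha> \<beta> = m"
      by auto
    define \<delta> where "\<delta> = (\<alpha> - \<beta>) / lambda"
    have \<alpha>: "\<alpha> = \<beta> + lambda * \<delta>" using lambda_nonzero by (simp add: \<delta>_def)
    show "(case case p of (\<alpha>, \<beta>) \<Rightarrow> ((\<alpha> - \<beta>) / lambda - lambda * \<beta>, (\<alpha> - \<beta>) / lambda) of
        (\<gamma>, \<delta>) \<Rightarrow> ((\<delta> - \<gamma>) / lambda + lambda * \<delta>, (\<delta> - \<gamma>) / lambda)) = p"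
      using lambda_nonzero by (simp add: p)
    obtain x y where xy: "x \<in> O_K" "y \<in> O_K" "\<alpha> = x + of_int k / lambda" "\<beta> = y + of_int k / lambda"
      using p by (auto simp: O_coset_def)
    have L: "\<delta> \<in> inv_different"
      unfolding inv_different_conv \<delta>_def
      by (rule bexI[of _ "x - y"]) (auto simp: xy intro!: O_K_diff)
    have "lambda * \<beta> = of_int k + lambda * y"
      using lambda_nonzero by (simp add: xy distrib_left)
    then have res: "has_residue (lambda * \<beta>) k 0" and "lambda * \<beta> \<in> O_K"
      using xy by (auto simp: has_residue_def intro!: O_K_closed)
    then have L': "\<delta> - lambda * \<beta> \<in> inv_different"
      using L O_K_subset_inv_different by (blast intro: inv_different_diff)
    have "?r (\<delta> - lambda * \<beta>) \<delta> = m"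
      unfolding p(4)[symmetric] \<alpha>
      by (rule monomial_transform[symmetric])
        (use L L' p O_coset_subset_K inv_different_subset_K \<alpha> in auto)
    with L L' res show "(case p of (\<alpha>, \<beta>) \<Rightarrow> ((\<alpha> - \<beta>) / lambda - lambda * \<beta>, (\<alpha> - \<beta>) / lambda)) \<in> ?R"
      by (simp add: p(1) theta_pairs_def flip: \<delta>_def)
  next
    fix p assume "p \<in> ?R"
    then obtain \<gamma> \<delta> where p: "p = (\<gamma>, \<delta>)" "\<gamma> \<in> inv_different" "\<delta> \<in> inv_different" "?r \<gamma> \<delta> = m"
      and res: "has_residue (\<delta> - \<gamma>) k 0"
      by (auto simp: theta_pairs_def)
    define \<beta> where "\<beta> = (\<delta> - \<gamma>) / lambda"
    have \<gamma>: "\<gamma> = \<delta> - lambda * \<beta>" using lambda_nonzero by (simp add: \<beta>_def)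
    show "(case case p of (\<gamma>, \<delta>) \<Rightarrow> ((\<delta> - \<gamma>) / lambda + lambda * \<delta>, (\<delta> - \<gamma>) / lambda) of
        (\<alpha>, \<beta>) \<Rightarrow> ((\<alpha> - \<beta>) / lambda - lambda * \<beta>, (\<alpha> - \<beta>) / lambda)) = p"
      using lambda_nonzero by (simp add: p)
    from res obtain y where y: "y \<in> O_K" "\<delta> - \<gamma> = of_int k + lambda * y"
      by (auto elim: has_residueE)
    have \<beta>: "\<beta> = y + of_int k / lambda"
      unfolding \<beta>_def y using lambda_nonzero by (simp add: field_simps)
    \<comment> \<open>This is the integral part of
      \<open>\<alpha> = \<beta> + lambda * \<delta>\<close>, which places \<open>\<alpha>\<close> in
      the same coset as \<open>\<beta>\<close>.\<close>
    have x: "lambda * \<delta> + y \<in> O_K"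
      using p(3) y(1) by (auto simp: inv_different_def intro: O_K_add)
    have "\<beta> + lambda * \<delta> = (lambda * \<delta> + y) + of_int k / lambda"
      by (simp add: \<beta>)
    with x \<beta> y(1) have C: "\<beta> \<in> O_coset k" "\<beta> + lambda * \<delta> \<in> O_coset k"
      unfolding O_coset_def by blast+
    have "?l (\<beta> + lambda * \<delta>) \<beta> = m"
      unfolding p(4)[symmetric] \<gamma>
      by (rule monomial_transform)
        (use C p O_coset_subset_K inv_different_subset_K \<gamma> in auto)
    with C show "(case p of (\<gamma>, \<delta>) \<Rightarrow> ((\<delta> - \<gamma>) / lambda + lambda * \<delta>, (\<delta> - \<gamma>) / lambda)) \<in> ?Q"
      by (simp add: p(1) flip: \<beta>_def)
  qed simp
  also have "\<dots> = (\<Sum>(\<gamma>, \<delta>)\<in>theta_pairs m. of_bool (has_residue (\<delta> - \<gamma>) k 0))"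
    by (rule sum.mono_neutral_cong_left[OF finite_theta_pairs]) auto
  finally show ?thesis .
qed

section \<open>Units acting on the second variable\<close>

text \<open>The second factor carries \<open>mono_one\<close> in place of \<open>z\<close> and
  \<open>w\<close>, so its monomial sees only the absolute value of \<open>\<delta>\<close>. The
  inverse \<open>v\<close> in \<open>O_K\<close> makes multiplication by \<open>u\<close> a
  bijection of the index set.\<close>

lemma sum_theta_pairs_unit:
  assumes u: "u \<in> O_K" "v \<in> O_K" "u * v = 1" "cmod u = 1"
  shows "(\<Sum>(\<gamma>, \<delta>)\<in>theta_pairs m. h \<gamma> (u * \<delta>)) = (\<Sum>(\<gamma>, \<delta>)\<in>theta_pairs m. h \<gamma> \<delta>)"
proof -
  have v: "cmod v = 1" using u(3,4) by (metis mult_1 norm_mult norm_one)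
  have closed: "(\<gamma>, w * \<delta>) \<in> theta_pairs m"
    if "(\<gamma>, \<delta>) \<in> theta_pairs m" "w \<in> O_K" "cmod w = 1" for \<gamma> \<delta> w
    using that by (auto simp: theta_pairs_def theta_monomial_conv Xq_def mono_one_def rat_norm_def
        norm_mult inv_different_mult)
  have vu: "v * u = 1" using u(3) by (simp add: mult.commute)
  show ?thesis
    by (rule sum.reindex_bij_witness[where i = "\<lambda>(\<gamma>, \<delta>). (\<gamma>, v * \<delta>)" and j = "\<lambda>(\<gamma>, \<delta>). (\<gamma>, u * \<delta>)"])
      (auto simp: u vu v closed simp flip: mult.assoc)
qed

lemma cmod_omega: "cmod omega = 1"
  by (simp add: omega_def)

lemma sum_theta_pairs_minus:
  "(\<Sum>(\<gamma>, \<delta>)\<in>theta_pairs m. h \<gamma> (- \<delta>)) = (\<Sum>(\<gamma>, \<delta>)\<in>theta_pairs m. h \<gamma> \<delta>)"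
  using sum_theta_pairs_unit[of "-1" "-1" h m] O_K_minus[OF one_in_O_K] by simp

lemma sum_theta_pairs_omega:
  "(\<Sum>(\<gamma>, \<delta>)\<in>theta_pairs m. h \<gamma> (omega * \<delta>)) = (\<Sum>(\<gamma>, \<delta>)\<in>theta_pairs m. h \<gamma> \<delta>)"
  using omega_cubed
  by (intro sum_theta_pairs_unit[of _ "omega * omega"])
    (simp_all add: cmod_omega O_K_mult power3_eq_cube mult.assoc)

lemma O_coset_minus_iff: "- \<alpha> \<in> O_coset k \<longleftrightarrow> \<alpha> \<in> O_coset (- k)"
proof -
  have "- \<alpha> \<in> O_coset k" if "\<alpha> \<in> O_coset (- k)" for \<alpha> k
  proof -
    from that obtain x where "x \<in> O_K" "\<alpha> = x + of_int (- k) / lambda" by (auto simp: O_coset_def)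
    then have "- x \<in> O_K" "- \<alpha> = - x + of_int k / lambda" by (auto intro: O_K_minus)
    then show ?thesis unfolding O_coset_def by blast
  qed
  from this[of \<alpha> k] this[of "- \<alpha>" "- k"] show ?thesis by auto
qed

text \<open>Multiplication by \<open>omega\<close> permutes cyclically the three classes modulo \<open>lambda\<close> inside a
  nontrivial coset of \<open>O_K\<close>, so each class carries a third of the sum.\<close>

lemma sum_theta_pairs_coset:
  assumes "\<not> 3 dvd j"
  shows "3 * (\<Sum>(\<gamma>, \<delta>)\<in>theta_pairs m.
      of_bool (\<gamma> \<in> O_coset j \<and> \<delta> \<in> O_coset j \<and> has_residue (\<delta> - \<gamma>) k 0))
    = (\<Sum>(\<gamma>, \<delta>)\<in>theta_pairs m. of_bool (\<gamma> \<in> O_coset j \<and> \<delta> \<in> O_coset j) :: complex)"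
proof -
  define h :: "complex \<Rightarrow> complex \<Rightarrow> complex" where
    "h \<gamma> \<delta> = of_bool (\<gamma> \<in> O_coset j \<and> \<delta> \<in> O_coset j \<and> has_residue (\<delta> - \<gamma>) k 0)" for \<gamma> \<delta>
  have "h \<gamma> \<delta> + h \<gamma> (omega * \<delta>) + h \<gamma> (omega * (omega * \<delta>))
      = of_bool (\<gamma> \<in> O_coset j \<and> \<delta> \<in> O_coset j)"
    if L: "\<gamma> \<in> inv_different" "\<delta> \<in> inv_different" for \<gamma> \<delta>
  proof -
    obtain a i where \<gamma>: "has_residue \<gamma> a i" using inv_different_has_residue L(1) .
    obtain c l where \<delta>: "has_residue \<delta> c l" using inv_different_has_residue L(2) .
    note \<delta>' = has_residue_omega_mult[OF \<delta>]
    note \<delta>'' = has_residue_omega_mult[OF \<delta>']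
    note diff = has_residue_diff[OF \<delta> \<gamma>] has_residue_diff[OF \<delta>' \<gamma>] has_residue_diff[OF \<delta>'' \<gamma>]
    note iffs = O_coset_iff_has_residue[OF \<gamma>] O_coset_iff_has_residue[OF \<delta>]
      O_coset_iff_has_residue[OF \<delta>'] O_coset_iff_has_residue[OF \<delta>''] diff[THEN has_residue_iff]
    show ?thesis
    proof (cases "3 dvd i - j \<and> 3 dvd l - j")
      case True
      then have "3 dvd l - i" "\<not> 3 dvd l" using assms by presburger+
      \<comment> \<open>Here \<open>l\<close> is invertible modulo 3, so \<open>c\<close>,
        \<open>c - l\<close> and \<open>c - 2 * l\<close> run through all residues and exactly one
        of them is \<open>a + k\<close>.\<close>
      then consider "3 dvd c - a - k" "\<not> 3 dvd c - l - a - k" "\<not> 3 dvd c - l - l - a - k"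
        | "\<not> 3 dvd c - a - k" "3 dvd c - l - a - k" "\<not> 3 dvd c - l - l - a - k"
        | "\<not> 3 dvd c - a - k" "\<not> 3 dvd c - l - a - k" "3 dvd c - l - l - a - k"
        by atomize_elim presburger
      then show ?thesis
        using True \<open>3 dvd l - i\<close> by cases (simp_all add: h_def iffs)
    qed (auto simp: h_def iffs)
  qed
  then have "(\<Sum>(\<gamma>, \<delta>)\<in>theta_pairs m. of_bool (\<gamma> \<in> O_coset j \<and> \<delta> \<in> O_coset j))
      = (\<Sum>(\<gamma>, \<delta>)\<in>theta_pairs m. h \<gamma> \<delta> + h \<gamma> (omega * \<delta>) + h \<gamma> (omega * (omega * \<delta>)))"
    by (intro sum.cong) (auto simp: theta_pairs_def)
  also have "\<dots> = (\<Sum>(\<gamma>, \<delta>)\<in>theta_pairs m. h \<gamma> \<delta>) + (\<Sum>(\<gamma>, \<delta>)\<in>theta_pairs m. h \<gamma> (omega * \<delta>))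
      + (\<Sum>(\<gamma>, \<delta>)\<in>theta_pairs m. h \<gamma> (omega * (omega * \<delta>)))"
    by (simp add: case_prod_unfold sum.distrib)
  also have "\<dots> = 3 * (\<Sum>(\<gamma>, \<delta>)\<in>theta_pairs m. h \<gamma> \<delta>)"
    using sum_theta_pairs_omega[of h] sum_theta_pairs_omega[of "\<lambda>\<gamma> \<delta>. h \<gamma> (omega * \<delta>)"] by simp
  finally show ?thesis by (simp add: h_def)
qed

section \<open>Sorting pairs by characters and cosets\<close>

text \<open>This is orthogonality for the exponent \<open>c - a - k\<close>. It calls for the
  inverse of \<open>chi \<delta>\<close> in one term, written here as
  \<open>chi (- \<delta>)\<close> so that the symmetry in \<open>\<delta>\<close> can later replace
  it by \<open>chi \<delta>\<close>.\<close>

lemma chi_sum_O_K: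
  assumes "\<gamma> \<in> O_K" "\<delta> \<in> O_K"
  shows "1 + omega powi k * (chi \<gamma> * chi (- \<delta>)) + omega powi (- k) * (chi \<gamma> powi (-1) * chi \<delta>)
    = 3 * of_bool (has_residue (\<delta> - \<gamma>) k 0)"
proof -
  obtain a i where \<gamma>: "has_residue \<gamma> a i"
    using inv_different_has_residue assms(1) O_K_subset_inv_different by blast
  obtain c l where \<delta>: "has_residue \<delta> c l"
    using inv_different_has_residue assms(2) O_K_subset_inv_different by blast
  have dvd: "3 dvd i" "3 dvd l"
    using assms O_K_iff_has_residue[OF \<gamma>] O_K_iff_has_residue[OF \<delta>] by auto
  have chi: "chi \<gamma> = omega powi a" "chi \<delta> = omega powi c" "chi (- \<delta>) = omega powi (- c)"
    using assms \<gamma> \<delta> has_residue_minus[OF \<delta>] by (auto intro!: chi_has_residue O_K_minus simp del: power_int_minus)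
  have "omega powi k * (chi \<gamma> * chi (- \<delta>)) = omega powi (- (c - a - k))"
    "omega powi (- k) * (chi \<gamma> powi (-1) * chi \<delta>) = omega powi (c - a - k)"
    unfolding chi using omega_nonzero
    by (simp_all add: power_int_add power_int_diff power_int_minus field_simps)
  then have "1 + omega powi k * (chi \<gamma> * chi (- \<delta>)) + omega powi (- k) * (chi \<gamma> powi (-1) * chi \<delta>)
      = 1 + omega powi (c - a - k) + omega powi (- (c - a - k))"
    by (simp only: add_ac)
  also have "\<dots> = 3 * of_bool (has_residue (\<delta> - \<gamma>) k 0)"
    unfolding omega_powi_sum using has_residue_iff[OF has_residue_diff[OF \<delta> \<gamma>]] dvd by simp
  finally show ?thesis .
qed

text \<open>The digit 0 says that \<open>\<gamma>\<close> and \<open>\<delta>\<close> lie in the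
  same coset of \<open>O_K\<close>, and the three cosets partition the inverse different.\<close>

lemma has_residue_diff_split:
  assumes "\<gamma> \<in> inv_different" "\<delta> \<in> inv_different"
  shows "(of_bool (has_residue (\<delta> - \<gamma>) k 0) :: complex) = 
    of_bool (\<gamma> \<in> O_K \<and> \<delta> \<in> O_K \<and> has_residue (\<delta> - \<gamma>) k 0)
    + of_bool (\<gamma> \<in> O_coset 1 \<and> \<delta> \<in> O_coset 1 \<and> has_residue (\<delta> - \<gamma>) k 0)
    + of_bool (\<gamma> \<in> O_coset (-1) \<and> \<delta> \<in> O_coset (-1) \<and> has_residue (\<delta> - \<gamma>) k 0)"
proof -
  obtain a i where \<gamma>: "has_residue \<gamma> a i" using inv_different_has_residue assms(1) .
  obtain c l where \<delta>: "has_residue \<delta> c l" using inv_different_has_residue assms(2) .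
  note iffs = O_coset_iff_has_residue[OF \<gamma>] O_coset_iff_has_residue[OF \<delta>] 
    has_residue_iff[OF has_residue_diff[OF \<delta> \<gamma>]] O_K_iff_has_residue[OF \<gamma>] O_K_iff_has_residue[OF \<delta>]
  show ?thesis
  proof (cases "3 dvd l - i")
    case True
    then consider "3 dvd i" "3 dvd l" "\<not> 3 dvd i - 1" "\<not> 3 dvd i + 1"
      | "\<not> 3 dvd i" "3 dvd i - 1" "3 dvd l - 1" "\<not> 3 dvd i + 1"
      | "\<not> 3 dvd i" "\<not> 3 dvd i - 1" "3 dvd i + 1" "3 dvd l + 1"
      by atomize_elim presburger
    then show ?thesis using True by cases (simp_all add: iffs)
  qed (simp add: iffs)
qed

section \<open>Assembly of the identity\<close>

lemma theta_identity:
  "3 \<odot> (c3 k Xq Xz Xw \<star> c3 k (Xq \<up> 2) (Xz \<up> 2) (Xw \<up> 2))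
    = a3 Xq Xw (Xz \<up> (-3)) \<star> a1 (Xq \<up> 2)
      + omega powi k \<odot> (b3 1 Xq Xw (Xz \<up> (-3)) \<star> b1 (Xq \<up> 2))
      + omega powi (-k) \<odot> (b3 (-1) Xq Xw (Xz \<up> (-3)) \<star> b1 (Xq \<up> 2))
      + c3 1 Xq Xw (Xz \<up> (-3)) \<star> c1 (Xq \<up> 2)
      + c3 (-1) Xq Xw (Xz \<up> (-3)) \<star> c1 (Xq \<up> 2)"
proof
  fix m
  define S where "S h = (\<Sum>(\<gamma>, \<delta>)\<in>theta_pairs m. h \<gamma> \<delta>)" for h :: "complex \<Rightarrow> complex \<Rightarrow> complex"
  have mult: "(theta_series I \<psi> Xq Xw (Xz \<up> (-3)) \<star> theta_series J \<phi> (Xq \<up> 2) mono_one mono_one) m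
      = S (\<lambda>\<gamma> \<delta>. of_bool (\<gamma> \<in> I \<and> \<delta> \<in> J) * (\<psi> \<gamma> * \<phi> \<delta>))"
    if "I \<subseteq> inv_different" "J \<subseteq> inv_different" for I J \<psi> \<phi>
    unfolding S_def by (rule theta_series_mult_theta_pairs[OF that])
  have S_cong: "S h = S h'" if "\<And>\<gamma> \<delta>. \<gamma> \<in> inv_different \<Longrightarrow> \<delta> \<in> inv_different \<Longrightarrow> h \<gamma> \<delta> = h' \<gamma> \<delta>" for h h'
    unfolding S_def by (rule sum.cong) (auto simp: theta_pairs_def that)
  have S_add: "S (\<lambda>\<gamma> \<delta>. h \<gamma> \<delta> + h' \<gamma> \<delta>) = S h + S h'" for h h'
    by (simp add: S_def case_prod_unfold sum.distrib)
  have S_mult: "S (\<lambda>\<gamma> \<delta>. z * h \<gamma> \<delta>) = z * S h" for z h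
    by (simp add: S_def case_prod_unfold sum_distrib_left)
  have S_minus: "S (\<lambda>\<gamma> \<delta>. h \<gamma> (- \<delta>)) = S h" for h
    unfolding S_def by (rule sum_theta_pairs_minus)
  define e :: "complex \<Rightarrow> complex \<Rightarrow> complex" where "e \<gamma> \<delta> = of_bool (\<gamma> \<in> O_K \<and> \<delta> \<in> O_K)" for \<gamma> \<delta>
  \<comment> \<open>\<open>E I\<close> is the share of the left-hand side, before the factor 3, from
    pairs with both entries in \<open>I\<close>.\<close>
  define E where "E I = S (\<lambda>\<gamma> \<delta>. of_bool (\<gamma> \<in> I \<and> \<delta> \<in> I \<and> has_residue (\<delta> - \<gamma>) k 0))" for I
  note subs = O_K_subset_inv_different O_coset_subset_inv_different
  have a: "(a3 Xq Xw (Xz \<up> (-3)) \<star> a1 (Xq \<up> 2)) m = S e"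
    by (simp add: a1_def a3_def mult subs e_def[abs_def])
  have b: "(b3 1 Xq Xw (Xz \<up> (-3)) \<star> b1 (Xq \<up> 2)) m = S (\<lambda>\<gamma> \<delta>. e \<gamma> \<delta> * (chi \<gamma> * chi \<delta>))"
    by (simp add: b1_def b3_def mult subs e_def)
  have b': "(b3 (-1) Xq Xw (Xz \<up> (-3)) \<star> b1 (Xq \<up> 2)) m = S (\<lambda>\<gamma> \<delta>. e \<gamma> \<delta> * (chi \<gamma> powi (-1) * chi \<delta>))"
    by (simp add: b1_def b3_def mult subs e_def del: power_int_minus)
  have c: "(c3 j Xq Xw (Xz \<up> (-3)) \<star> c1 (Xq \<up> 2)) m
      = S (\<lambda>\<gamma> \<delta>. of_bool (\<gamma> \<in> O_coset j \<and> \<delta> \<in> O_coset 1))" for j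
    by (simp add: c1_def c3_def mult subs)
  have E_coset: "3 * E (O_coset j) = S (\<lambda>\<gamma> \<delta>. of_bool (\<gamma> \<in> O_coset j \<and> \<delta> \<in> O_coset j))" if "\<not> 3 dvd j" for j
    unfolding E_def S_def by (rule sum_theta_pairs_coset[OF that])
  \<comment> \<open>Averaging leaves \<open>\<delta>\<close> in \<open>O_coset (-1)\<close>, whereas
    the factor \<open>c1\<close> sums over \<open>O_coset 1\<close>; the sign change of
    \<open>\<delta>\<close> reconciles them.\<close>
  have c_neg: "3 * E (O_coset (-1)) = S (\<lambda>\<gamma> \<delta>. of_bool (\<gamma> \<in> O_coset (-1) \<and> \<delta> \<in> O_coset 1))"
    using E_coset[of "-1"] S_minus[of "\<lambda>\<gamma> \<delta>. of_bool (\<gamma> \<in> O_coset (-1) \<and> \<delta> \<in> O_coset 1)"]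
    by (simp add: O_coset_minus_iff)
  have "3 * E O_K = S (\<lambda>\<gamma> \<delta>. e \<gamma> \<delta> + omega powi k * (e \<gamma> \<delta> * (chi \<gamma> * chi (- \<delta>)))
      + omega powi (-k) * (e \<gamma> \<delta> * (chi \<gamma> powi (-1) * chi \<delta>)))"
    unfolding E_def S_mult[symmetric]
  proof (rule S_cong)
    fix \<gamma> \<delta>
    show "3 * of_bool (\<gamma> \<in> O_K \<and> \<delta> \<in> O_K \<and> has_residue (\<delta> - \<gamma>) k 0)
      = e \<gamma> \<delta> + omega powi k * (e \<gamma> \<delta> * (chi \<gamma> * chi (- \<delta>)))
      + omega powi (-k) * (e \<gamma> \<delta> * (chi \<gamma> powi (-1) * chi \<delta>))"
      using chi_sum_O_K[of \<gamma> \<delta> k]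
      by (cases "\<gamma> \<in> O_K \<and> \<delta> \<in> O_K") (auto simp: e_def simp del: power_int_minus)
  qed
  then have E_O_K: "3 * E O_K = S e + omega powi k * S (\<lambda>\<gamma> \<delta>. e \<gamma> \<delta> * (chi \<gamma> * chi (- \<delta>)))
      + omega powi (-k) * S (\<lambda>\<gamma> \<delta>. e \<gamma> \<delta> * (chi \<gamma> powi (-1) * chi \<delta>))"
    by (simp only: S_add S_mult)
  have "e \<gamma> (- \<delta>) = e \<gamma> \<delta>" for \<gamma> \<delta>
    using O_coset_minus_iff[of \<delta> 0] by (simp add: e_def O_coset_zero)
  \<comment> \<open>The weight \<open>e\<close> is even in \<open>\<delta>\<close>, so the same sign
    change removes the minus sign left by orthogonality and yields the factor
    \<open>b1\<close>.\<close>
  then have b_minus: "S (\<lambda>\<gamma> \<delta>. e \<gamma> \<delta> * (chi \<gamma> * chi (- \<delta>))) = S (\<lambda>\<gamma> \<delta>. e \<gamma> \<delta> * (chi \<gamma> * chi \<delta>))"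
    using S_minus[of "\<lambda>\<gamma> \<delta>. e \<gamma> \<delta> * (chi \<gamma> * chi \<delta>)"] by simp
  have "(c3 k Xq Xz Xw \<star> c3 k (Xq \<up> 2) (Xz \<up> 2) (Xw \<up> 2)) m
      = S (\<lambda>\<gamma> \<delta>. of_bool (has_residue (\<delta> - \<gamma>) k 0))"
    unfolding S_def by (rule c3_mult_theta_pairs)
  also have "\<dots> = E O_K + E (O_coset 1) + E (O_coset (-1))"
    unfolding E_def S_add[symmetric] by (intro S_cong has_residue_diff_split)
  finally have "(3 \<odot> (c3 k Xq Xz Xw \<star> c3 k (Xq \<up> 2) (Xz \<up> 2) (Xw \<up> 2))) m
      = 3 * E O_K + 3 * E (O_coset 1) + 3 * E (O_coset (-1))"
    by (simp add: ser_smult_def)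
  also have "\<dots> = (a3 Xq Xw (Xz \<up> (-3)) \<star> a1 (Xq \<up> 2)
      + omega powi k \<odot> (b3 1 Xq Xw (Xz \<up> (-3)) \<star> b1 (Xq \<up> 2))
      + omega powi (-k) \<odot> (b3 (-1) Xq Xw (Xz \<up> (-3)) \<star> b1 (Xq \<up> 2))
      + c3 1 Xq Xw (Xz \<up> (-3)) \<star> c1 (Xq \<up> 2)
      + c3 (-1) Xq Xw (Xz \<up> (-3)) \<star> c1 (Xq \<up> 2)) m"
    unfolding plus_fun_apply ser_smult_def a b b' c E_O_K b_minus c_neg
    using E_coset[of 1] by simp
  finally show "(3 \<odot> (c3 k Xq Xz Xw \<star> c3 k (Xq \<up> 2) (Xz \<up> 2) (Xw \<up> 2))) m = \<dots>" .
qed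

lemma c3_zero: "c3 0 = a3"
  by (simp add: c3_def a3_def O_coset_zero)

theorem theorem2:
  shows "(\<forall>k::int.
      3 \<odot> (c3 k Xq Xz Xw \<star> c3 k (Xq \<up> 2) (Xz \<up> 2) (Xw \<up> 2))
      = a3 Xq Xw (Xz \<up> (-3)) \<star> a1 (Xq \<up> 2)
        + omega powi k \<odot> (b3 1 Xq Xw (Xz \<up> (-3)) \<star> b1 (Xq \<up> 2))
        + omega powi (-k) \<odot> (b3 (-1) Xq Xw (Xz \<up> (-3)) \<star> b1 (Xq \<up> 2))
        + c3 1 Xq Xw (Xz \<up> (-3)) \<star> c1 (Xq \<up> 2)
        + c3 (-1) Xq Xw (Xz \<up> (-3)) \<star> c1 (Xq \<up> 2))
    \<and> 3 \<odot> (a3 Xq Xz Xw \<star> a3 (Xq \<up> 2) (Xz \<up> 2) (Xw \<up> 2))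
      = a3 Xq Xw (Xz \<up> (-3)) \<star> a1 (Xq \<up> 2)
        + b3 1 Xq Xw (Xz \<up> (-3)) \<star> b1 (Xq \<up> 2)
        + b3 (-1) Xq Xw (Xz \<up> (-3)) \<star> b1 (Xq \<up> 2)
        + c3 1 Xq Xw (Xz \<up> (-3)) \<star> c1 (Xq \<up> 2)
        + c3 (-1) Xq Xw (Xz \<up> (-3)) \<star> c1 (Xq \<up> 2)"
  using theta_identity theta_identity[of 0] by (simp add: c3_zero ser_smult_def)

end
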